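(* Let $0\le\delta<\tfrac12$, $\alpha>1$ and $\beta>1$ be reals, and let $A$ be an $(\alpha,\beta,\delta)$-decision algorithm. Let $\phi$ be a Boolean formula in $m\ge1$ variables and run the algorithm $C_A(\phi)$. Then: (1) $C_A(\phi)$ terminates after $k\le\lceil\log_2 m\rceil$ iterations, returning an interval $I_k=[l,u]$ with $u-l\le 2\max(\alpha,\beta)+2$; (2) the probability that $\#\phi\notin[\lfloor 2^l\rfloor,\lceil 2^u\rceil]$ is at most $\lceil\log_2 m\rceil\,\delta$.
   Context: For a Boolean formula $\phi$, $\#\phi$ denotes its number of models (satisfying assignments). Given reals $0\le\delta<\tfrac12$, $\alpha>1$, $\beta>1$, an $(\alpha,\beta,\delta)$-decision algorithm is a probabilistic algorithm $A(\cdot,\cdot)$ which takes an integer $s$ and a Boolean formula $\phi$ and returns $0$ or $1$, such that for every integer $s\ge0$ and every formula $\phi$: (i) if $\#\phi>2^{s+\beta}$ then $\Pr(A(s,\phi)=0)\le\delta$; (ii) if $\#\phi<2^{s-\alpha}$ then $\Pr(A(s,\phi)=1)\le\delta$. The counting algorithm $C_A(\phi)$, for $\phi$ with $m$ variables, is defined as follows (each call to $A$ uses fresh independent randomness). Let $I_0=[l_0,u_0]=[-1,m]$. For $k\ge0$, given $I_k=[l_k,u_k]$: (a) if $u_k-l_k\le 2\max(\alpha,\beta)+1$ or $k=\lceil\log_2 m\rceil$, return $I_k$; (b) otherwise let $s=\mathrm{round}\big(\tfrac{u_k+l_k}{2}\big)$ (rounding to a nearest integer); if $A(s,\phi)=0$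 set $I_{k+1}=[l_k,s+\beta]$, otherwise set $I_{k+1}=[s-\alpha,u_k]$. *)

theory Defs
  imports "HOL-Probability.Probability"
begin

datatype (vars: 'v) formula =
    Const bool
  | Var 'v
  | Neg "'v formula"
  | Conj "'v formula" "'v formula"
  | Disj "'v formula" "'v formula"

primrec sat :: "('v \<Rightarrow> bool) \<Rightarrow> 'v formula \<Rightarrow> bool" where
  "sat \<sigma> (Const b) = b"
| "sat \<sigma> (Var x) = \<sigma> x"
| "sat \<sigma> (Neg \<phi>) = (\<not> sat \<sigma> \<phi>)"
| "sat \<sigma> (Conj \<phi> \<psi>) = (sat \<sigma> \<phi> \<and> sat \<sigma> \<psi>)"
| "sat \<sigma> (Disj \<phi> \<psi>) = (sat \<sigma> \<phi> \<or> sat \<sigma> \<psi>)"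

definition num_vars :: "'v formula \<Rightarrow> nat" where
  "num_vars \<phi> = card (vars \<phi>)"

text \<open>A model assigns truth values exactly to the variables occurring in the formula; assignments
  are therefore taken to be extensional, so that each is counted once.\<close>

definition models :: "'v formula \<Rightarrow> ('v \<Rightarrow> bool) set" where
  "models \<phi> = {\<sigma> \<in> vars \<phi> \<rightarrow>\<^sub>E UNIV. sat \<sigma> \<phi>}"

definition num_models :: "'v formula \<Rightarrow> nat" where
  "num_models \<phi> = card (models \<phi>)"

text \<open>A probabilistic algorithm with answers 0 and 1 is identified with the distribution of its
  answer on each input, where 0 is \<^const>\<open>False\<close> and 1 is \<^const>\<open>True\<close>.\<close>

definition decision_algorithm ::
    "real \<Rightarrow> real \<Rightarrow> real \<Rightarrow> (int \<Rightarrow> 'v formula \<Rightarrow> bool pmf) \<Rightarrow> bool" where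
  "decision_algorithm \<alpha> \<beta> \<delta> A \<longleftrightarrow>
     (\<forall>s \<phi>. 0 \<le> s \<longrightarrow>
        (real (num_models \<phi>) > 2 powr (real_of_int s + \<beta>) \<longrightarrow> pmf (A s \<phi>) False \<le> \<delta>) \<and>
        (real (num_models \<phi>) < 2 powr (real_of_int s - \<alpha>) \<longrightarrow> pmf (A s \<phi>) True \<le> \<delta>))"

text \<open>Ties may be broken arbitrarily; \<^const>\<open>round\<close> is one instance.\<close>

definition rounds_to_nearest :: "(real \<Rightarrow> int) \<Rightarrow> bool" where
  "rounds_to_nearest rnd \<longleftrightarrow> (\<forall>x. \<bar>real_of_int (rnd x) - x\<bar> \<le> 1 / 2)"

text \<open>The loop of the counting algorithm, entered with iteration index \<open>k\<close> and interval
  \<open>[l, u]\<close>. Its result is the returned interval together with the index at which it was returned.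
  Being a least fixed point of subprobability distributions, the loop loses exactly the probability
  of divergence, so termination is not built into the definition. Sequencing by
  \<^const>\<open>bind_spmf\<close> gives each call to \<open>A\<close> fresh independent randomness.\<close>

partial_function (spmf) count_loop ::
    "(real \<Rightarrow> int) \<Rightarrow> real \<Rightarrow> real \<Rightarrow> (int \<Rightarrow> 'v formula \<Rightarrow> bool pmf) \<Rightarrow> 'v formula \<Rightarrow>
     nat \<Rightarrow> real \<Rightarrow> real \<Rightarrow> (nat \<times> real \<times> real) spmf" where
  "count_loop rnd \<alpha> \<beta> A \<phi> k l u =
     (if u - l \<le> 2 * max \<alpha> \<beta> + 1 \<or> int k = \<lceil>log 2 (real (num_vars \<phi>))\<rceil>
      then return_spmf (k, l, u)
      else let s = rnd ((u + l) / 2) in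
        bind_spmf (spmf_of_pmf (A s \<phi>)) (\<lambda>answer.
          if answer then count_loop rnd \<alpha> \<beta> A \<phi> (k + 1) (real_of_int s - \<alpha>) u
          else count_loop rnd \<alpha> \<beta> A \<phi> (k + 1) l (real_of_int s + \<beta>)))"

definition counting_algorithm ::
    "(real \<Rightarrow> int) \<Rightarrow> real \<Rightarrow> real \<Rightarrow> (int \<Rightarrow> 'v formula \<Rightarrow> bool pmf) \<Rightarrow> 'v formula \<Rightarrow>
     (nat \<times> real \<times> real) spmf" where
  "counting_algorithm rnd \<alpha> \<beta> A \<phi> = count_loop rnd \<alpha> \<beta> A \<phi> 0 (- 1) (real (num_vars \<phi>))"

end

theory Submission
  imports Defs
begin

text \<open>Write \<open>M = max \<alpha> \<beta>\<close> and \<open>K = \<lceil>log\<^sub>2 m\<rceil>\<close>. A bisection step turns an interval of width \<open>w\<close> into one of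
  width at most \<open>w / 2 + M + 1 / 2\<close>, a map whose fixed point is \<open>2 M + 1\<close>. Hence the excess of the
  width over \<open>2 M + 1\<close> is halved by each step; it is at most \<open>m \<le> 2 ^ K\<close> at the beginning and so at
  most \<open>1\<close> after \<open>K\<close> steps. A step from an interval wider than \<open>2 M + 1\<close> does not decrease the lower
  end, so \<open>l \<ge> - 1\<close> throughout and \<open>A\<close> is only queried at \<open>s \<ge> 0\<close>. The number of models can leave the
  current interval only through an answer of \<open>A\<close> that has probability at most \<open>\<delta>\<close>, and as \<open>\<delta> < 1 / 2\<close>
  only one of the two answers can be that unlikely; a union bound over at most \<open>K\<close> queries concludes.\<close>

lemma finite_vars: "finite (vars \<phi>)"
  by (induction \<phi>) auto

lemma num_models_le: "num_models \<phi> \<le> 2 ^ num_vars \<phi>"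
proof -
  have "card (models \<phi>) \<le> card (vars \<phi> \<rightarrow>\<^sub>E (UNIV :: bool set))"
    unfolding models_def by (intro card_mono finite_PiE) (auto simp: finite_vars)
  then show ?thesis
    by (simp add: num_models_def num_vars_def card_PiE finite_vars)
qed

text \<open>Total probability over the answer of one query: it splits the error of the loop into the
  errors of its two continuations.\<close>

lemma measure_bind_spmf_of_bool_pmf:
  "measure (measure_spmf (bind_spmf (spmf_of_pmf p) f)) B =
     pmf p True * measure (measure_spmf (f True)) B + pmf p False * measure (measure_spmf (f False)) B"
proof -
  have "measure (measure_spmf (bind_spmf (spmf_of_pmf p) f)) B =
      measure_pmf.expectation p (\<lambda>x. measure (measure_spmf (f x)) B)"
    unfolding bind_spmf_of_pmf measure_measure_spmf_conv_measure_pmf measure_pmf_bind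
    by (subst measure_pmf.measure_bind[where N = "count_space UNIV"])
      (auto simp: space_subprob_algebra measure_pmf.subprob_space_axioms)
  also have "\<dots> = (\<Sum>x\<in>UNIV. pmf p x * measure (measure_spmf (f x)) B)"
    by (subst integral_measure_pmf_real[of UNIV]) (auto simp: mult.commute)
  finally show ?thesis
    by (simp add: UNIV_bool)
qed

text \<open>Rounding moves \<open>s\<close> by at most \<open>1 / 2\<close> from the midpoint, which
  lies more than \<open>max \<alpha> \<beta> + 1 / 2\<close> above \<open>l\<close>. This leaves
  room for the margin \<alpha> below \<open>s\<close>; the same \<open>1 / 2\<close> enters the new
  widths.\<close>

lemma bisection_step:
  fixes \<alpha> \<beta> l u :: real
  assumes "rounds_to_nearest rnd" and "u - l > 2 * max \<alpha> \<beta> + 1"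
  defines "s \<equiv> rnd ((u + l) / 2)"
  shows "l \<le> real_of_int s - \<alpha>" and "l + max \<alpha> \<beta> \<le> real_of_int s"
    and "u - (real_of_int s - \<alpha>) \<le> (u - l) / 2 + max \<alpha> \<beta> + 1 / 2"
    and "real_of_int s + \<beta> - l \<le> (u - l) / 2 + max \<alpha> \<beta> + 1 / 2"
proof -
  have "\<bar>real_of_int s - (u + l) / 2\<bar> \<le> 1 / 2"
    using assms(1) unfolding s_def rounds_to_nearest_def by blast
  then have "real_of_int s \<le> (u + l) / 2 + 1 / 2" and "(u + l) / 2 - 1 / 2 \<le> real_of_int s"
    by linarith+
  moreover have "\<alpha> \<le> max \<alpha> \<beta>" "\<beta> \<le> max \<alpha> \<beta>"
    by auto
  ultimately show "l \<le> real_of_int s - \<alpha>" and "l + max \<alpha> \<beta> \<le> real_of_int s"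
    and "u - (real_of_int s - \<alpha>) \<le> (u - l) / 2 + max \<alpha> \<beta> + 1 / 2"
    and "real_of_int s + \<beta> - l \<le> (u - l) / 2 + max \<alpha> \<beta> + 1 / 2"
    using assms(2) unfolding add_divide_distrib diff_divide_distrib by linarith+
qed

text \<open>Induction on the number \<open>n\<close> of iterations left before the cap on
  \<open>k\<close>. The allowed excess \<open>2 ^ n\<close> is \<open>1\<close> at
  \<open>n = 0\<close>, where the cap forces a return.\<close>

lemma count_loop_terminates:
  assumes "rounds_to_nearest rnd"
    and "int (k + n) = \<lceil>log 2 (real (num_vars \<phi>))\<rceil>"
    and "u - l \<le> 2 * max \<alpha> \<beta> + 1 + 2 ^ n"
  shows "lossless_spmf (count_loop rnd \<alpha> \<beta> A \<phi> k l u) \<and>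
    (\<forall>(k', l', u') \<in> set_spmf (count_loop rnd \<alpha> \<beta> A \<phi> k l u).
       k' \<le> k + n \<and> u' - l' \<le> 2 * max \<alpha> \<beta> + 2)"
  using assms(2,3)
proof (induction n arbitrary: k l u)
  case 0
  then show ?case
    by (simp add: count_loop.simps)
next
  case (Suc n)
  show ?case
  proof (cases "u - l \<le> 2 * max \<alpha> \<beta> + 1")
    case True
    then show ?thesis
      by (simp add: count_loop.simps)
  next
    case False
    define s where "s = rnd ((u + l) / 2)"
    from False have wide: "u - l > 2 * max \<alpha> \<beta> + 1"
      by simp
    \<comment> \<open>Half of \<open>2 * max \<alpha> \<beta> + 1 + 2 ^ Suc n\<close>, plus
      \<open>max \<alpha> \<beta> + 1 / 2\<close>, is exactly the bound for
      \<open>n\<close>.\<close>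
    have step: "u - (real_of_int s - \<alpha>) \<le> 2 * max \<alpha> \<beta> + 1 + 2 ^ n"
      "real_of_int s + \<beta> - l \<le> 2 * max \<alpha> \<beta> + 1 + 2 ^ n"
      using bisection_step(3,4)[OF assms(1) wide] Suc.prems(2)
      unfolding s_def by (simp_all add: field_simps)
    define up where "up = count_loop rnd \<alpha> \<beta> A \<phi> (k + 1) (real_of_int s - \<alpha>) u"
    define down where "down = count_loop rnd \<alpha> \<beta> A \<phi> (k + 1) l (real_of_int s + \<beta>)"
    have unfold: "count_loop rnd \<alpha> \<beta> A \<phi> k l u =
        bind_spmf (spmf_of_pmf (A s \<phi>)) (\<lambda>answer. if answer then up else down)"
      using False Suc.prems(1)
      by (subst count_loop.simps) (simp add: s_def up_def down_def Let_def cong: if_cong)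
    have "int (k + 1 + n) = \<lceil>log 2 (real (num_vars \<phi>))\<rceil>"
      using Suc.prems(1) by simp
    note IH = Suc.IH[OF this step(1), folded up_def] Suc.IH[OF this step(2), folded down_def]
    have "lossless_spmf (count_loop rnd \<alpha> \<beta> A \<phi> k l u)"
      using IH by (simp add: unfold)
    moreover have "set_spmf (count_loop rnd \<alpha> \<beta> A \<phi> k l u) \<subseteq> set_spmf up \<union> set_spmf down"
      unfolding unfold set_bind_spmf by (auto simp: bind_UNION split: if_splits)
    ultimately show ?thesis
      using IH by auto
  qed
qed

text \<open>At most \<open>n\<close> queries are still to come, and each adds at most \<delta> to
  the error. The count lies in the current interval, so all error stems from these queries.\<close>

lemma measure_count_loop_error_le:
  assumes "0 \<le> \<delta>" and "\<delta> < 1 / 2" and "\<alpha> > 1"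
    and "rounds_to_nearest rnd" and "decision_algorithm \<alpha> \<beta> \<delta> A"
    and "int (k + n) = \<lceil>log 2 (real (num_vars \<phi>))\<rceil>"
    and "- 1 \<le> l" and "int (num_models \<phi>) \<in> {\<lfloor>2 powr l\<rfloor>..\<lceil>2 powr u\<rceil>}"
  shows "measure (measure_spmf (count_loop rnd \<alpha> \<beta> A \<phi> k l u))
      {(k, l, u). int (num_models \<phi>) \<notin> {\<lfloor>2 powr l\<rfloor>..\<lceil>2 powr u\<rceil>}} \<le> real n * \<delta>"
    (is "measure _ ?B \<le> _")
  using assms(6-)
proof (induction n arbitrary: k l u)
  case 0
  then show ?case
    by (simp add: count_loop.simps measure_spmf_return_spmf measure_return)
next
  case (Suc n)
  show ?case
  proof (cases "u - l \<le> 2 * max \<alpha> \<beta> + 1")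
    case True
    then show ?thesis
      using Suc.prems assms(1) by (simp add: count_loop.simps measure_spmf_return_spmf measure_return)
  next
    case False
    define s where "s = rnd ((u + l) / 2)"
    define up where "up = count_loop rnd \<alpha> \<beta> A \<phi> (k + 1) (real_of_int s - \<alpha>) u"
    define down where "down = count_loop rnd \<alpha> \<beta> A \<phi> (k + 1) l (real_of_int s + \<beta>)"
    have unfold: "count_loop rnd \<alpha> \<beta> A \<phi> k l u =
        bind_spmf (spmf_of_pmf (A s \<phi>)) (\<lambda>answer. if answer then up else down)"
      using False Suc.prems(1)
      by (subst count_loop.simps) (simp add: s_def up_def down_def Let_def cong: if_cong)
    have l_mono: "l \<le> real_of_int s - \<alpha>" and "l + max \<alpha> \<beta> \<le> real_of_int s"
      using bisection_step(1,2)[OF assms(4), of \<alpha> \<beta> u l] False unfolding s_def by simp_all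
    \<comment> \<open>Here \<alpha> > 1 outweighs the initial lower end \<open>- 1\<close>, so the
      guarantees of \<open>A\<close> apply at \<open>s\<close>.\<close>
    then have "0 \<le> s"
      using Suc.prems(2) assms(3) by linarith
    have k: "int (k + 1 + n) = \<lceil>log 2 (real (num_vars \<phi>))\<rceil>"
      using Suc.prems(1) by simp
    \<comment> \<open>Answer 0 keeps the lower end. Either the new upper end still covers the count
      and the induction hypothesis applies, or the count is so large that answer 0 is
      unlikely.\<close>
    have down_error: "measure (measure_spmf down) ?B \<le> real n * \<delta> \<or> pmf (A s \<phi>) False \<le> \<delta>"
    proof (cases "int (num_models \<phi>) \<le> \<lceil>2 powr (real_of_int s + \<beta>)\<rceil>")
      case True
      then show ?thesis
        using Suc.IH[OF k, of l "real_of_int s + \<beta>"] Suc.prems(2,3) by (simp add: down_def)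
    next
      case False
      then have "2 powr (real_of_int s + \<beta>) < real (num_models \<phi>)"
        by linarith
      then show ?thesis
        using assms(5) \<open>0 \<le> s\<close> unfolding decision_algorithm_def by blast
    qed
    have up_error: "measure (measure_spmf up) ?B \<le> real n * \<delta> \<or> pmf (A s \<phi>) True \<le> \<delta>"
    proof (cases "\<lfloor>2 powr (real_of_int s - \<alpha>)\<rfloor> \<le> int (num_models \<phi>)")
      case True
      then show ?thesis
        using Suc.IH[OF k, of "real_of_int s - \<alpha>" u] Suc.prems(2,3) l_mono by (simp add: up_def)
    next
      case False
      then have "real (num_models \<phi>) < 2 powr (real_of_int s - \<alpha>)"
        by linarith
      then show ?thesis
        using assms(5) \<open>0 \<le> s\<close> unfolding decision_algorithm_def by blast
    qed
    define x where "x = measure (measure_spmf up) ?B"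
    define y where "y = measure (measure_spmf down) ?B"
    define p where "p = pmf (A s \<phi>) True"
    define q where "q = pmf (A s \<phi>) False"
    have pq: "0 \<le> p" "0 \<le> q" "p + q = 1"
      by (simp_all add: p_def q_def pmf_False_conv_True pmf_le_1)
    have xy: "x \<le> 1" "y \<le> 1"
      by (simp_all add: x_def y_def measure_spmf.subprob_measure_le_1)
    have n\<delta>: "0 \<le> real n * \<delta>"
      using assms(1) by simp
    \<comment> \<open>The fourth combination, \<open>p \<le> \<delta>\<close> and
      \<open>q \<le> \<delta>\<close>, would give \<open>p + q < 1\<close>.\<close>
    consider "x \<le> real n * \<delta>" "y \<le> real n * \<delta>" | "x \<le> real n * \<delta>" "q \<le> \<delta>"
      | "p \<le> \<delta>" "y \<le> real n * \<delta>"
      using up_error down_error assms(2) pq unfolding x_def y_def p_def q_def by linarith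
    then have "p * x + q * y \<le> real n * \<delta> + \<delta>"
    proof cases
      case 1
      then have "p * x + q * y \<le> real n * \<delta>"
        using pq by (intro convex_bound_le) auto
      then show ?thesis
        using assms(1) by linarith
    next
      \<comment> \<open>The unlikely answer costs at most its own probability, since
        \<open>y \<le> 1\<close>; the other costs at most the error of its continuation.\<close>
      case 2
      have "p * x \<le> 1 * (real n * \<delta>)" "q * y \<le> q * 1"
        using 2 pq xy n\<delta> by (intro mult_mono; simp add: x_def y_def)+
      then show ?thesis
        using 2 by linarith
    next
      case 3
      have "p * x \<le> p * 1" "q * y \<le> 1 * (real n * \<delta>)"
        using 3 pq xy n\<delta> by (intro mult_mono; simp add: x_def y_def)+
      then show ?thesis
        using 3 by linarith
    qed
    then show ?thesis
      unfolding unfold measure_bind_spmf_of_bool_pmf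
      by (simp add: x_def y_def p_def q_def algebra_simps)
  qed
qed

theorem theorem1:
  fixes \<alpha> \<beta> \<delta> :: real
    and rnd :: "real \<Rightarrow> int"
    and A :: "int \<Rightarrow> 'v formula \<Rightarrow> bool pmf"
    and \<phi> :: "'v formula"
    and m :: nat
  assumes "0 \<le> \<delta>" and "\<delta> < 1 / 2" and "\<alpha> > 1" and "\<beta> > 1"
    and "rounds_to_nearest rnd"
    and "decision_algorithm \<alpha> \<beta> \<delta> A"
    and "num_vars \<phi> = m" and "m \<ge> 1"
  shows "(lossless_spmf (counting_algorithm rnd \<alpha> \<beta> A \<phi>) \<and>
          (\<forall>(k, l, u) \<in> set_spmf (counting_algorithm rnd \<alpha> \<beta> A \<phi>).
             int k \<le> \<lceil>log 2 (real m)\<rceil> \<and> u - l \<le> 2 * max \<alpha> \<beta> + 2)) \<and>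
         measure (measure_spmf (counting_algorithm rnd \<alpha> \<beta> A \<phi>))
           {(k, l, u). int (num_models \<phi>) \<notin> {\<lfloor>2 powr l\<rfloor>..\<lceil>2 powr u\<rceil>}}
         \<le> real_of_int \<lceil>log 2 (real m)\<rceil> * \<delta>"
proof -
  define K where "K = nat \<lceil>log 2 (real m)\<rceil>"
  have "0 \<le> log 2 (real m)"
    using assms(8) by simp
  then have K: "int K = \<lceil>log 2 (real m)\<rceil>"
    unfolding K_def by simp
  have "log 2 (real m) \<le> real K"
    using K by linarith
  then have "real m \<le> 2 ^ K"
    using assms(8) by (simp add: log_le_iff powr_realpow)
  then have width: "real m - (- 1) \<le> 2 * max \<alpha> \<beta> + 1 + 2 ^ K"
    using assms(3) max.cobounded1[of \<alpha> \<beta>] by linarith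
  have K': "int (0 + K) = \<lceil>log 2 (real (num_vars \<phi>))\<rceil>"
    using K assms(7) by simp
  have "real (num_models \<phi>) \<le> 2 ^ m"
    using num_models_le[of \<phi>] assms(7) by (metis of_nat_le_iff of_nat_numeral of_nat_power)
  \<comment> \<open>At \<open>l = - 1\<close> the floor is \<open>0\<close>, so an unsatisfiable
    formula is covered as well; starting at \<open>l = 0\<close> would exclude it.\<close>
  then have init: "int (num_models \<phi>) \<in> {\<lfloor>2 powr (- 1 :: real)\<rfloor>..\<lceil>2 powr real m\<rceil>}"
    by (simp add: powr_realpow powr_minus)
  have "lossless_spmf (counting_algorithm rnd \<alpha> \<beta> A \<phi>) \<and>
      (\<forall>(k, l, u) \<in> set_spmf (counting_algorithm rnd \<alpha> \<beta> A \<phi>).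
         k \<le> 0 + K \<and> u - l \<le> 2 * max \<alpha> \<beta> + 2)"
    unfolding counting_algorithm_def assms(7)
    by (rule count_loop_terminates[OF assms(5) K' width])
  moreover have "measure (measure_spmf (counting_algorithm rnd \<alpha> \<beta> A \<phi>))
      {(k, l, u). int (num_models \<phi>) \<notin> {\<lfloor>2 powr l\<rfloor>..\<lceil>2 powr u\<rceil>}} \<le> real K * \<delta>"
    unfolding counting_algorithm_def assms(7)
    by (rule measure_count_loop_error_le[OF assms(1-3,5,6) K' _ init]) simp
  ultimately show ?thesis
    unfolding K[symmetric] by auto
qed

end
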